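(* Let $(X,\mathcal{B})$ be a bornological universe where $X$ is a Tychonoff space. Then $(X,\mathcal{B})$ is realcompact if and only if $X$ is realcompact as a topological space and $\mathcal{B}$ contains only relatively compact subsets of $X$.
   Context: A bornology on a set $X$ is a set $\mathcal{B}\subseteq 2^X$ such that $\{x\}\in\mathcal{B}$ for each $x\in X$; $B\in\mathcal{B}$ and $A\subseteq B$ imply $A\in\mathcal{B}$; and $A\cup B\in\mathcal{B}$ whenever $A,B\in\mathcal{B}$. A bornological universe $(X,\mathcal{B})$ is a topological space $X$ endowed with a bornology $\mathcal{B}$ on its underlying set. Tychonoff means completely regular and Hausdorff. $\mathcal{C}_{\mathcal{B}}(X)$ is the set of all continuous real valued maps on $X$ that are bounded on every element of $\mathcal{B}$. For $X$ Tychonoff and a continuous $f:X\to\mathbb{R}$, $f^{\beta}$ denotes the unique continuous map from the Stone–Čech compactification $\beta(X)$ to the one-point compactification $\mathbb{R}\cup\{\infty\}$ whose restriction to $X$ is $f$. Put $\upsilon_{\mathcal{B}}(X)=\{x\in\beta(X)\mid \forall f\in\mathcal{C}_{\mathcal{B}}(X): f^{\beta}(x)\neq\infty\}$, a subspace of $\beta(X)$ containing $X$. The bornological universe $(X,\mathcal{B})$ is realcompact if $\upsilon_{\mathcal{B}}(X)=X$. The topological space $X$ is realcompact if it equals its Hewitt realcompactification $\upsilon(X)=\{x\in\beta(X)\mid f^{\beta}(x)\neq\infty \text{ for all continuous } f:X\to\mathbb{R}\}$. A subset of $X$ is relatively compact if its closure in $X$ is compact. *)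

theory Defs
  imports "HOL-Analysis.Analysis"
begin

definition bornology_on :: "'a set \<Rightarrow> 'a set set \<Rightarrow> bool" where
  "bornology_on S \<B> \<longleftrightarrow>
     \<B> \<subseteq> Pow S \<and>
     (\<forall>x\<in>S. {x} \<in> \<B>) \<and>
     (\<forall>A B. B \<in> \<B> \<and> A \<subseteq> B \<longrightarrow> A \<in> \<B>) \<and>
     (\<forall>A\<in>\<B>. \<forall>B\<in>\<B>. A \<union> B \<in> \<B>)"

definition bornological_universe :: "'a topology \<Rightarrow> 'a set set \<Rightarrow> bool" where
  "bornological_universe X \<B> \<longleftrightarrow> bornology_on (topspace X) \<B>"

definition relatively_compactin :: "'a topology \<Rightarrow> 'a set \<Rightarrow> bool" where
  "relatively_compactin X A \<longleftrightarrow> A \<subseteq> topspace X \<and> compactin X (X closure_of A)"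


text \<open>The Stone-Cech compactification is the closure of the image of the evaluation map in the
  cube \<open>[0,1]\<close> to the power \<open>unit_maps X\<close>. Functions that agree on \<open>topspace X\<close> but differ outside
  it give separate but identical coordinates on that closure, which does not affect the space up to
  homeomorphism.\<close>

definition unit_maps :: "'a topology \<Rightarrow> ('a \<Rightarrow> real) set" where
  "unit_maps X = {f. continuous_map X (top_of_set {0..1}) f}"

definition unit_cube :: "'a topology \<Rightarrow> (('a \<Rightarrow> real) \<Rightarrow> real) topology" where
  "unit_cube X = product_topology (\<lambda>_. top_of_set {0..1}) (unit_maps X)"

definition stone_cech_embed :: "'a topology \<Rightarrow> 'a \<Rightarrow> ('a \<Rightarrow> real) \<Rightarrow> real" where
  "stone_cech_embed X x = (\<lambda>f\<in>unit_maps X. f x)"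

definition stone_cech :: "'a topology \<Rightarrow> (('a \<Rightarrow> real) \<Rightarrow> real) topology" where
  "stone_cech X =
     subtopology (unit_cube X) (unit_cube X closure_of (stone_cech_embed X ` topspace X))"

text \<open>The extension of \<open>f\<close> to a map into the one-point compactification of the reals, whose point at
  infinity is \<open>None\<close>. The extensionality condition only fixes the values outside the Stone-Cech
  compactification; existence and uniqueness are shown in \<open>stone_cech_ext_ex1\<close>.\<close>

definition stone_cech_ext ::
    "'a topology \<Rightarrow> ('a \<Rightarrow> real) \<Rightarrow> (('a \<Rightarrow> real) \<Rightarrow> real) \<Rightarrow> real option" where
  "stone_cech_ext X f =
     (THE g. g \<in> extensional (topspace (stone_cech X)) \<and>
             continuous_map (stone_cech X) (Alexandroff_compactification euclideanreal) g \<and>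
             (\<forall>x\<in>topspace X. g (stone_cech_embed X x) = Some (f x)))"

definition bounded_maps :: "'a topology \<Rightarrow> 'a set set \<Rightarrow> ('a \<Rightarrow> real) set" where
  "bounded_maps X \<B> = {f. continuous_map X euclideanreal f \<and> (\<forall>B\<in>\<B>. bounded (f ` B))}"

definition bornological_realcompactification ::
    "'a topology \<Rightarrow> 'a set set \<Rightarrow> (('a \<Rightarrow> real) \<Rightarrow> real) set" where
  "bornological_realcompactification X \<B> =
     {z \<in> topspace (stone_cech X). \<forall>f\<in>bounded_maps X \<B>. stone_cech_ext X f z \<noteq> None}"

definition hewitt_realcompactification :: "'a topology \<Rightarrow> (('a \<Rightarrow> real) \<Rightarrow> real) set" where
  "hewitt_realcompactification X =
     {z \<in> topspace (stone_cech X).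
        \<forall>f. continuous_map X euclideanreal f \<longrightarrow> stone_cech_ext X f z \<noteq> None}"

text \<open>As usual, \<open>X\<close> is identified with its image in the Stone-Cech compactification.\<close>

definition realcompact_universe :: "'a topology \<Rightarrow> 'a set set \<Rightarrow> bool" where
  "realcompact_universe X \<B> \<longleftrightarrow>
     bornological_realcompactification X \<B> = stone_cech_embed X ` topspace X"

definition realcompact_space :: "'a topology \<Rightarrow> bool" where
  "realcompact_space X \<longleftrightarrow> hewitt_realcompactification X = stone_cech_embed X ` topspace X"


subsection \<open>Well-definedness\<close>

lemma unit_maps_range: "f \<in> unit_maps X \<Longrightarrow> x \<in> topspace X \<Longrightarrow> f x \<in> {0..1}"
  unfolding unit_maps_def by (force simp: continuous_map_def)

lemma topspace_unit_cube: "topspace (unit_cube X) = (\<Pi>\<^sub>E f\<in>unit_maps X. {0..1})"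
  by (simp add: unit_cube_def)

lemma compact_space_unit_cube: "compact_space (unit_cube X)"
proof -
  have "compact_space (top_of_set {0..1::real})"
    using compact_space_subtopology[of euclideanreal "{0..1}"] by simp
  then show ?thesis
    by (simp add: unit_cube_def compact_space_product_topology)
qed

lemma Hausdorff_space_unit_cube: "Hausdorff_space (unit_cube X)"
  by (simp add: unit_cube_def Hausdorff_space_product_topology Hausdorff_space_subtopology)

lemma stone_cech_embed_in: "x \<in> topspace X \<Longrightarrow> stone_cech_embed X x \<in> topspace (unit_cube X)"
  unfolding topspace_unit_cube stone_cech_embed_def using unit_maps_range[of _ X x] by auto

lemma topspace_stone_cech:
  "topspace (stone_cech X) = unit_cube X closure_of (stone_cech_embed X ` topspace X)"
  by (simp add: stone_cech_def closure_of_subset_topspace Int_absorb1)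

lemma stone_cech_embed_in_stone_cech:
  "stone_cech_embed X ` topspace X \<subseteq> topspace (stone_cech X)"
  unfolding topspace_stone_cech by (rule closure_of_subset) (auto intro: stone_cech_embed_in)

lemma compact_space_stone_cech: "compact_space (stone_cech X)"
  unfolding stone_cech_def
  by (intro compact_space_subtopology closedin_compact_space compact_space_unit_cube
        closedin_closure_of)

lemma Hausdorff_space_stone_cech: "Hausdorff_space (stone_cech X)"
  unfolding stone_cech_def by (simp add: Hausdorff_space_subtopology Hausdorff_space_unit_cube)

lemma dense_stone_cech_embed:
  "stone_cech X closure_of (stone_cech_embed X ` topspace X) = topspace (stone_cech X)"
proof -
  let ?S = "stone_cech_embed X ` topspace X" and ?C = "unit_cube X closure_of (stone_cech_embed X ` topspace X)"
  have "?C \<inter> ?S = ?S"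
    using stone_cech_embed_in_stone_cech[of X] unfolding topspace_stone_cech by blast
  then have "subtopology (unit_cube X) ?C closure_of ?S = ?C"
    by (simp only: closure_of_subtopology Int_absorb)
  then show ?thesis
    by (simp only: topspace_stone_cech) (simp only: stone_cech_def)
qed

lemma continuous_map_stone_cech_embed_cube:
  "continuous_map X (unit_cube X) (stone_cech_embed X)"
proof -
  have "continuous_map X (top_of_set {0..1::real}) (\<lambda>x. stone_cech_embed X x f)"
    if "f \<in> unit_maps X" for f
    using that by (simp add: stone_cech_embed_def unit_maps_def)
  moreover have "stone_cech_embed X ` topspace X \<subseteq> extensional (unit_maps X)"
    by (auto simp: stone_cech_embed_def)
  ultimately show ?thesis
    unfolding unit_cube_def by (auto simp: continuous_map_componentwise)
qed

lemma continuous_map_stone_cech_embed: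
  "continuous_map X (stone_cech X) (stone_cech_embed X)"
proof -
  have "stone_cech_embed X \<in> topspace X \<rightarrow> unit_cube X closure_of (stone_cech_embed X ` topspace X)"
    using stone_cech_embed_in_stone_cech[of X] unfolding topspace_stone_cech by blast
  then show ?thesis
    unfolding stone_cech_def continuous_map_in_subtopology
    using continuous_map_stone_cech_embed_cube by blast
qed

lemma inj_on_stone_cech_embed:
  assumes "completely_regular_space X" "Hausdorff_space X"
  shows "inj_on (stone_cech_embed X) (topspace X)"
proof (rule inj_onI, rule ccontr)
  fix x y
  assume x: "x \<in> topspace X" and y: "y \<in> topspace X" and ne: "x \<noteq> y"
    and eq: "stone_cech_embed X x = stone_cech_embed X y"
  have "closedin X {y}"
    by (simp add: assms(2) closedin_Hausdorff_singleton y)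
  moreover have "x \<in> topspace X - {y}"
    using x ne by simp
  ultimately obtain f :: "'a \<Rightarrow> real"
    where f: "continuous_map X (top_of_set {0..1}) f" "f x = 0" "f ` {y} \<subseteq> {1}"
    using assms(1) unfolding completely_regular_space_def by metis
  then have "f \<in> unit_maps X" by (simp add: unit_maps_def)
  then have "f x = f y"
    using fun_cong[OF eq, of f] by (simp add: stone_cech_embed_def)
  with f show False by auto
qed

lemma embedding_map_stone_cech_embed_cube:
  assumes "completely_regular_space X" "Hausdorff_space X"
  shows "embedding_map X (unit_cube X) (stone_cech_embed X)"
  unfolding embedding_map_def
proof (rule bijective_open_imp_homeomorphic_map)
  let ?e = "stone_cech_embed X"
  show "continuous_map X (subtopology (unit_cube X) (?e ` topspace X)) ?e"
    using continuous_map_stone_cech_embed_cube by (auto simp: continuous_map_in_subtopology)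
  show "?e ` topspace X = topspace (subtopology (unit_cube X) (?e ` topspace X))"
    using stone_cech_embed_in by auto
  show "inj_on ?e (topspace X)"
    by (rule inj_on_stone_cech_embed[OF assms])
  show "open_map X (subtopology (unit_cube X) (?e ` topspace X)) ?e"
    unfolding open_map_def
  proof (intro allI impI)
    fix U assume U: "openin X U"
    then have UX: "U \<subseteq> topspace X" by (rule openin_subset)
    show "openin (subtopology (unit_cube X) (?e ` topspace X)) (?e ` U)"
    proof (subst openin_subopen, intro ballI)
      fix z assume "z \<in> ?e ` U"
      then obtain x where x: "x \<in> U" "z = ?e x" by auto
      have "closedin X (topspace X - U)" "x \<in> topspace X - (topspace X - U)"
        using U x UX by auto
      then obtain f :: "'a \<Rightarrow> real"
        where f: "continuous_map X (top_of_set {0..1}) f" "f x = 0" "f ` (topspace X - U) \<subseteq> {1}"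
        using assms(1) unfolding completely_regular_space_def by meson
      then have fm: "f \<in> unit_maps X" by (simp add: unit_maps_def)
      define W where "W = {w \<in> topspace (unit_cube X). w f \<in> {..<1}}"
      have "continuous_map (unit_cube X) (top_of_set {0..1}) (\<lambda>w. w f)"
        unfolding unit_cube_def by (rule continuous_map_product_projection[OF fm])
      then have "continuous_map (unit_cube X) euclideanreal (\<lambda>w. w f)"
        by (simp add: continuous_map_in_subtopology)
      then have W: "openin (unit_cube X) W"
        unfolding W_def by (rule openin_continuous_map_preimage) auto
      have ef: "?e y f = f y" for y using fm by (simp add: stone_cech_embed_def)
      have "?e x \<in> W" using x UX f(2) stone_cech_embed_in[of x X] by (auto simp: W_def ef)
      moreover have "W \<inter> ?e ` topspace X \<subseteq> ?e ` U"
        using f(3) by (force simp: W_def ef)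
      moreover have "openin (subtopology (unit_cube X) (?e ` topspace X)) (W \<inter> ?e ` topspace X)"
        using W by (auto simp: openin_subtopology)
      moreover have "z \<in> W \<inter> ?e ` topspace X"
        using calculation(1) x UX by auto
      ultimately show "\<exists>T. openin (subtopology (unit_cube X) (?e ` topspace X)) T \<and> z \<in> T \<and> T \<subseteq> ?e ` U"
        by metis
    qed
  qed
qed

lemma embedding_map_stone_cech_embed:
  assumes "completely_regular_space X" "Hausdorff_space X"
  shows "embedding_map X (stone_cech X) (stone_cech_embed X)"
proof -
  let ?S = "stone_cech_embed X ` topspace X" and ?C = "unit_cube X closure_of (stone_cech_embed X ` topspace X)"
  have "?C \<inter> ?S = ?S"
    using stone_cech_embed_in_stone_cech[of X] unfolding topspace_stone_cech by blast
  then have "subtopology (stone_cech X) ?S = subtopology (unit_cube X) ?S"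
    by (simp only: stone_cech_def subtopology_subtopology)
  then show ?thesis
    using embedding_map_stone_cech_embed_cube[OF assms] by (simp only: embedding_map_def)
qed

lemma stone_cech_extension:
  assumes K: "compact_space K" "Hausdorff_space K" and f: "continuous_map X K f"
  obtains g where "continuous_map (stone_cech X) K g"
    and "\<And>x. x \<in> topspace X \<Longrightarrow> g (stone_cech_embed X x) = f x"
proof -
  let ?e = "stone_cech_embed X" and ?k = "stone_cech_embed K"
  have crK: "completely_regular_space K"
    by (simp add: K compact_Hausdorff_or_regular_imp_normal_space normal_imp_completely_regular_space)
  have hom: "homeomorphic_map K (subtopology (unit_cube K) (?k ` topspace K)) ?k"
    using embedding_map_stone_cech_embed_cube[OF crK K(2)] by (simp add: embedding_map_def)
  then obtain h where h: "homeomorphic_maps K (subtopology (unit_cube K) (?k ` topspace K)) ?k h"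
    using homeomorphic_map_maps by blast
  define F where "F = (\<lambda>z. \<lambda>u\<in>unit_maps K. z (u \<circ> f) :: real)"
  have comp: "u \<circ> f \<in> unit_maps X" if "u \<in> unit_maps K" for u
    using that f unfolding unit_maps_def by (auto intro: continuous_map_compose)
  have F: "continuous_map (unit_cube X) (unit_cube K) F"
  proof -
    have "continuous_map (unit_cube X) (top_of_set {0..1}) (\<lambda>z. F z u)" if "u \<in> unit_maps K" for u
      using continuous_map_product_projection[OF comp[OF that], of "\<lambda>_. top_of_set {0..1::real}"] that
      by (simp add: F_def unit_cube_def)
    moreover have "F ` topspace (unit_cube X) \<subseteq> extensional (unit_maps K)"
      by (auto simp: F_def)
    ultimately show ?thesis
      by (subst unit_cube_def) (auto simp: continuous_map_componentwise)
  qed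
  have Fe: "F (?e x) = ?k (f x)" for x
    by (auto simp: F_def stone_cech_embed_def comp restrict_def)
  have fK: "f x \<in> topspace K" if "x \<in> topspace X" for x
    using f that by (force simp: continuous_map_def)
  have "compactin (unit_cube K) (?k ` topspace K)"
    using K(1) continuous_map_stone_cech_embed_cube[of K] image_compactin
    unfolding compact_space_def by blast
  then have cl: "closedin (unit_cube K) (?k ` topspace K)"
    using Hausdorff_space_unit_cube compactin_imp_closedin by blast
  have "F ` (unit_cube X closure_of (?e ` topspace X)) \<subseteq> unit_cube K closure_of (F ` ?e ` topspace X)"
    using F by (simp add: continuous_map_image_closure_subset)
  also have "\<dots> \<subseteq> ?k ` topspace K"
    using cl by (intro closure_of_minimal) (auto simp: Fe fK)
  finally have "continuous_map (stone_cech X) (subtopology (unit_cube K) (?k ` topspace K)) F"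
    using F unfolding stone_cech_def
    by (fastforce simp: continuous_map_in_subtopology continuous_map_from_subtopology)
  then have "continuous_map (stone_cech X) K (h \<circ> F)"
    using h by (auto simp: homeomorphic_maps_def intro: continuous_map_compose)
  moreover have "(h \<circ> F) (?e x) = f x" if "x \<in> topspace X" for x
    using h fK[OF that] by (simp add: Fe homeomorphic_maps_def)
  ultimately show ?thesis using that by blast
qed

lemma compact_Hausdorff_Alexandroff_real:
  "compact_space (Alexandroff_compactification euclideanreal)"
  "Hausdorff_space (Alexandroff_compactification euclideanreal)"
  by (simp_all add: Hausdorff_space_Alexandroff_compactification locally_compact_space_euclidean)

lemma stone_cech_ext_ex1:
  assumes "continuous_map X euclideanreal f"
  shows "\<exists>!g. g \<in> extensional (topspace (stone_cech X)) \<and>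
              continuous_map (stone_cech X) (Alexandroff_compactification euclideanreal) g \<and>
              (\<forall>x\<in>topspace X. g (stone_cech_embed X x) = Some (f x))"
proof -
  let ?A = "Alexandroff_compactification euclideanreal" and ?T = "topspace (stone_cech X)"
  have "continuous_map X ?A (Some \<circ> f)"
    using assms continuous_map_Some by (rule continuous_map_compose)
  then obtain g where g: "continuous_map (stone_cech X) ?A g"
    "\<And>x. x \<in> topspace X \<Longrightarrow> g (stone_cech_embed X x) = (Some \<circ> f) x"
    using stone_cech_extension[OF compact_Hausdorff_Alexandroff_real] by metis
  have "continuous_map (stone_cech X) ?A (restrict g ?T)"
    by (rule continuous_map_eq[OF g(1)]) auto
  then have ex: "restrict g ?T \<in> extensional ?T \<and> continuous_map (stone_cech X) ?A (restrict g ?T) \<and>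
      (\<forall>x\<in>topspace X. restrict g ?T (stone_cech_embed X x) = Some (f x))"
    using g(2) stone_cech_embed_in_stone_cech[of X] by auto
  define r where "r = restrict g ?T"
  note ex' = ex[folded r_def]
  have uniq: "k = r"
    if k: "k \<in> extensional ?T \<and> continuous_map (stone_cech X) ?A k \<and>
      (\<forall>x\<in>topspace X. k (stone_cech_embed X x) = Some (f x))" for k
  proof (rule extensionalityI[of _ ?T])
    fix z assume "z \<in> ?T"
    then have "z \<in> stone_cech X closure_of (stone_cech_embed X ` topspace X)"
      by (simp add: dense_stone_cech_embed)
    then show "k z = r z"
      by (rule forall_in_closure_of_eq[OF _ compact_Hausdorff_Alexandroff_real(2)])
        (use k ex' in auto)
  qed (use k ex' in auto)
  show ?thesis
    unfolding Ex1_def using ex' uniq by (intro exI[of _ "r"]) blast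
qed

lemma stone_cech_ext:
  assumes "continuous_map X euclideanreal f"
  shows "continuous_map (stone_cech X) (Alexandroff_compactification euclideanreal) (stone_cech_ext X f)"
    and "x \<in> topspace X \<Longrightarrow> stone_cech_ext X f (stone_cech_embed X x) = Some (f x)"
  using theI'[OF stone_cech_ext_ex1[OF assms]] by (simp_all add: stone_cech_ext_def)

end

theory Submission
  imports Defs
begin

text \<open>Both directions compare \<open>\<upsilon>\<^sub>\<B>(X)\<close> with \<open>\<upsilon>(X)\<close>. Fewer test functions cut out a larger
  subspace, so \<open>X \<subseteq> \<upsilon>(X) \<subseteq> \<upsilon>\<^sub>\<B>(X)\<close> always. Hence a realcompact
  universe has a realcompact underlying space. If every member of \<open>\<B>\<close> is relatively compact,
  then every continuous real function is bounded on every member, so the two classes of test functions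
  and with them the two subspaces coincide.

  It remains to see that realcompactness of the universe forces each \<open>B \<in> \<B>\<close> to be relatively
  compact. A function that is bounded on \<open>B\<close> has an extension to \<open>\<beta>(X)\<close> that stays, on the
  closure of \<open>B\<close> in \<open>\<beta>(X)\<close>, inside a compact interval, hence away from \<open>\<infinity>\<close>.
  So this closure is contained in \<open>\<upsilon>\<^sub>\<B>(X)\<close>
  (\<open>closure_of_member_subset\<close>). If \<open>\<upsilon>\<^sub>\<B>(X) = X\<close>, it is a compact
  subset of \<open>X\<close> that contains \<open>B\<close>.\<close>

lemma stone_cech_embed_subset_hewitt:
  "stone_cech_embed X ` topspace X \<subseteq> hewitt_realcompactification X"
  using stone_cech_embed_in_stone_cech[of X]
  by (auto simp: hewitt_realcompactification_def stone_cech_ext(2))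

lemma hewitt_subset_bornological_realcompactification:
  "hewitt_realcompactification X \<subseteq> bornological_realcompactification X \<B>"
  by (auto simp: hewitt_realcompactification_def bornological_realcompactification_def
      bounded_maps_def)

lemma bounded_image_of_relatively_compactin:
  assumes "continuous_map X euclideanreal f" and "relatively_compactin X B"
  shows "bounded (f ` B)"
proof -
  have B: "B \<subseteq> topspace X" "compactin X (X closure_of B)"
    using assms(2) by (auto simp: relatively_compactin_def)
  then have "compact (f ` (X closure_of B))"
    using image_compactin[OF B(2) assms(1)] by simp
  moreover have "f ` B \<subseteq> f ` (X closure_of B)"
    using closure_of_subset[OF B(1)] by (rule image_mono)
  ultimately show ?thesis
    by (meson bounded_subset compact_imp_bounded)
qed

lemma bornological_realcompactification_eq_hewitt:
  assumes "\<forall>B\<in>\<B>. relatively_compactin X B"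
  shows "bornological_realcompactification X \<B> = hewitt_realcompactification X"
proof -
  have "bounded_maps X \<B> = {f. continuous_map X euclideanreal f}"
    using assms bounded_image_of_relatively_compactin by (auto simp: bounded_maps_def)
  then show ?thesis
    by (auto simp: bornological_realcompactification_def hewitt_realcompactification_def)
qed

text \<open>A compact interval containing \<open>f ` B\<close> stays closed in the one-point compactification, so the
  extension of \<open>f\<close> maps into it on the whole closure of \<open>B\<close>.\<close>

lemma stone_cech_ext_finite_on_closure:
  assumes f: "continuous_map X euclideanreal f"
    and B: "B \<subseteq> topspace X" "bounded (f ` B)"
    and z: "z \<in> stone_cech X closure_of (stone_cech_embed X ` B)"
  shows "stone_cech_ext X f z \<noteq> None"
proof -
  let ?A = "Alexandroff_compactification euclideanreal" and ?g = "stone_cech_ext X f"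
  have "compact (closure (f ` B))"
    using B(2) by (simp add: compact_closure)
  then have "compactin euclideanreal (closure (f ` B))"
    by simp
  then have "compactin ?A (Some ` closure (f ` B))"
    using continuous_map_Some by (rule image_compactin)
  then have closed: "closedin ?A (Some ` closure (f ` B))"
    by (intro compactin_imp_closedin compact_Hausdorff_Alexandroff_real(2))
  have "?g ` stone_cech_embed X ` B \<subseteq> Some ` closure (f ` B)"
    using B(1) stone_cech_ext(2)[OF f] closure_subset[of "f ` B"] by (auto simp: subset_iff)
  then have "?A closure_of (?g ` stone_cech_embed X ` B) \<subseteq> Some ` closure (f ` B)"
    using closed by (rule closure_of_minimal)
  moreover have "?g z \<in> ?A closure_of (?g ` stone_cech_embed X ` B)"
    using continuous_map_image_closure_subset[OF stone_cech_ext(1)[OF f]] z by blast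
  ultimately show ?thesis
    by auto
qed

lemma closure_of_member_subset:
  assumes "B \<in> \<B>" and "B \<subseteq> topspace X"
  shows "stone_cech X closure_of (stone_cech_embed X ` B) \<subseteq> bornological_realcompactification X \<B>"
  using assms stone_cech_ext_finite_on_closure[of X _ B]
    closure_of_subset_topspace[of "stone_cech X" "stone_cech_embed X ` B"]
  by (auto simp: bornological_realcompactification_def bounded_maps_def)

text \<open>The closure in \<open>\<beta>(X)\<close> is compact, so it transfers back to a compact subset of \<open>X\<close> along
  the embedding as soon as it lies in the image.\<close>

lemma relatively_compactin_if_closure_in_image:
  assumes X: "completely_regular_space X" "Hausdorff_space X" and B: "B \<subseteq> topspace X"
    and sub: "stone_cech X closure_of (stone_cech_embed X ` B) \<subseteq> stone_cech_embed X ` topspace X"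
  shows "relatively_compactin X B"
proof -
  let ?e = "stone_cech_embed X"
  define C where "C = stone_cech X closure_of (?e ` B)"
  define K where "K = {x \<in> topspace X. ?e x \<in> C}"
  have K: "K \<subseteq> topspace X" and eK: "?e ` K = C"
    using sub by (auto simp: K_def C_def)
  have "compactin (stone_cech X) C"
    unfolding C_def by (simp add: closedin_compact_space compact_space_stone_cech)
  then have "compactin (subtopology (stone_cech X) (?e ` topspace X)) (?e ` K)"
    using K by (auto simp: compactin_subtopology eK[symmetric])
  then have compact: "compactin X K"
    using homeomorphic_map_compactness[OF _ K] embedding_map_stone_cech_embed[OF X]
    unfolding embedding_map_def by blast
  have "?e ` B \<subseteq> C"
    unfolding C_def using B stone_cech_embed_in_stone_cech[of X] by (intro closure_of_subset) auto
  then have "B \<subseteq> K"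
    using B by (auto simp: K_def)
  then have "X closure_of B \<subseteq> K"
    by (rule closure_of_minimal) (rule compactin_imp_closedin[OF X(2) compact])
  then show ?thesis
    using B closed_compactin[OF compact] by (simp add: relatively_compactin_def)
qed

theorem proposition14:
  fixes X :: "'a topology" and \<B> :: "'a set set"
  assumes "bornological_universe X \<B>"
    and "completely_regular_space X" and "Hausdorff_space X"
  shows "realcompact_universe X \<B> \<longleftrightarrow>
         realcompact_space X \<and> (\<forall>B\<in>\<B>. relatively_compactin X B)"
proof
  assume universe: "realcompact_universe X \<B>"
  then have "realcompact_space X"
    using stone_cech_embed_subset_hewitt[of X]
      hewitt_subset_bornological_realcompactification[of X \<B>]
    by (auto simp: realcompact_universe_def realcompact_space_def)
  moreover have "relatively_compactin X B" if "B \<in> \<B>" for B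
  proof (rule relatively_compactin_if_closure_in_image[OF assms(2,3)])
    show B: "B \<subseteq> topspace X"
      using assms(1) that by (auto simp: bornological_universe_def bornology_on_def)
    show "stone_cech X closure_of (stone_cech_embed X ` B) \<subseteq> stone_cech_embed X ` topspace X"
      using closure_of_member_subset[OF that B] universe by (simp add: realcompact_universe_def)
  qed
  ultimately show "realcompact_space X \<and> (\<forall>B\<in>\<B>. relatively_compactin X B)"
    by blast
next
  assume "realcompact_space X \<and> (\<forall>B\<in>\<B>. relatively_compactin X B)"
  then show "realcompact_universe X \<B>"
    using bornological_realcompactification_eq_hewitt[of \<B> X]
    by (simp add: realcompact_universe_def realcompact_space_def)
qed

end
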